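(* Let $\mathbb{F}$ be a field and let $A$ be a commutative $\mathbb{F}$-algebra with $n:=\dim(A)<\infty$. Then there exist an evolution $\mathbb{F}$-algebra $X$ of dimension $\frac{n(n+1)}{2}$ and an $\mathbb{F}$-algebra morphism $\psi\colon A\longrightarrow X$ such that: (a) $\psi$ is a monomorphism; (b) $\psi(A)$ is an ideal of $X$; (c) $X/\psi(A)$ is a degenerate algebra.
   Context: An algebra over a field $\mathbb{F}$ is an $\mathbb{F}$-vector space with a bilinear multiplication, not assumed associative or unital. Algebra morphisms are linear multiplicative maps (not required to preserve a unit). An algebra $E$ over $\mathbb{F}$ is an evolution algebra if it admits a basis $\{e_i : i\in I\}$, called a natural basis, such that $e_ie_j=0$ whenever $i\neq j$. Here an algebra is called degenerate if its multiplication is identically zero. *)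

theory Defs
  imports "Jordan_Normal_Form.Missing_VectorSpace" "HOL-Algebra.QuotRing"
begin

text \<open>
  Algebras over a field that need not be associative, commutative or unital. An algebra is carried
  by a record of type \<^type>\<open>module\<close>, with \<open>mult\<close> as its product; the field \<open>one\<close> of
  that record is never constrained or used. The locale \<open>algebra\<close> of HOL-Algebra is unsuitable
  here, since it requires a commutative unital ring.
\<close>

locale nonassoc_algebra = vectorspace K A for K (structure) and A (structure) +
  assumes product_closed:
      "\<lbrakk>x \<in> carrier A; y \<in> carrier A\<rbrakk> \<Longrightarrow> x \<otimes>\<^bsub>A\<^esub> y \<in> carrier A"
    and product_add_left:
      "\<lbrakk>x \<in> carrier A; y \<in> carrier A; z \<in> carrier A\<rbrakk> \<Longrightarrow>
        (x \<oplus>\<^bsub>A\<^esub> y) \<otimes>\<^bsub>A\<^esub> z = (x \<otimes>\<^bsub>A\<^esub> z) \<oplus>\<^bsub>A\<^esub> (y \<otimes>\<^bsub>A\<^esub> z)"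
    and product_add_right:
      "\<lbrakk>x \<in> carrier A; y \<in> carrier A; z \<in> carrier A\<rbrakk> \<Longrightarrow>
        x \<otimes>\<^bsub>A\<^esub> (y \<oplus>\<^bsub>A\<^esub> z) = (x \<otimes>\<^bsub>A\<^esub> y) \<oplus>\<^bsub>A\<^esub> (x \<otimes>\<^bsub>A\<^esub> z)"
    and product_smult_left:
      "\<lbrakk>c \<in> carrier K; x \<in> carrier A; y \<in> carrier A\<rbrakk> \<Longrightarrow>
        (c \<odot>\<^bsub>A\<^esub> x) \<otimes>\<^bsub>A\<^esub> y = c \<odot>\<^bsub>A\<^esub> (x \<otimes>\<^bsub>A\<^esub> y)"
    and product_smult_right:
      "\<lbrakk>c \<in> carrier K; x \<in> carrier A; y \<in> carrier A\<rbrakk> \<Longrightarrow>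
        x \<otimes>\<^bsub>A\<^esub> (c \<odot>\<^bsub>A\<^esub> y) = c \<odot>\<^bsub>A\<^esub> (x \<otimes>\<^bsub>A\<^esub> y)"

locale commutative_nonassoc_algebra = nonassoc_algebra +
  assumes product_commute:
    "\<lbrakk>x \<in> carrier A; y \<in> carrier A\<rbrakk> \<Longrightarrow> x \<otimes>\<^bsub>A\<^esub> y = y \<otimes>\<^bsub>A\<^esub> x"

definition (in nonassoc_algebra) natural_basis :: "'c set \<Rightarrow> bool" where
  "natural_basis B \<longleftrightarrow>
    basis B \<and> (\<forall>x\<in>B. \<forall>y\<in>B. x \<noteq> y \<longrightarrow> x \<otimes>\<^bsub>A\<^esub> y = \<zero>\<^bsub>A\<^esub>)"

locale evolution_algebra = nonassoc_algebra +
  assumes natural_basis_exists: "\<exists>B. natural_basis B"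

locale degenerate_algebra = nonassoc_algebra +
  assumes product_zero:
    "\<lbrakk>x \<in> carrier A; y \<in> carrier A\<rbrakk> \<Longrightarrow> x \<otimes>\<^bsub>A\<^esub> y = \<zero>\<^bsub>A\<^esub>"

locale nonassoc_algebra_hom =
  dom: nonassoc_algebra K A + cod: nonassoc_algebra K B + linear_map K A B f
  for K and A and B and f +
  assumes hom_product:
    "\<lbrakk>x \<in> carrier A; y \<in> carrier A\<rbrakk> \<Longrightarrow> f (x \<otimes>\<^bsub>A\<^esub> y) = f x \<otimes>\<^bsub>B\<^esub> f y"

locale nonassoc_algebra_ideal = nonassoc_algebra K A + subspace K I A for K and I and A +
  assumes ideal_left: "\<lbrakk>a \<in> carrier A; x \<in> I\<rbrakk> \<Longrightarrow> a \<otimes>\<^bsub>A\<^esub> x \<in> I"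
    and ideal_right: "\<lbrakk>a \<in> carrier A; x \<in> I\<rbrakk> \<Longrightarrow> x \<otimes>\<^bsub>A\<^esub> a \<in> I"

text \<open>
  \<open>A Quot I\<close> supplies the additive cosets of \<open>I\<close> with their sum and product
  (its definition does not need the product of \<open>A\<close> to be associative); the scalar
  multiplication \<open>c (I + x) = I + c x\<close> is added to it. The union serves to avoid a choice
  of representatives.
\<close>

definition quotient_algebra ::
    "('k, 'a, 'm) module_scheme \<Rightarrow> 'a set \<Rightarrow> ('k, 'a set) module" where
  "quotient_algebra A I =
    ring.extend (A Quot I) (module.fields (\<lambda>c U. \<Union>u\<in>U. I +>\<^bsub>A\<^esub> (c \<odot>\<^bsub>A\<^esub> u)))"

end

theory Submission
  imports Defs
begin

text \<open>
  The idea is to find \<open>N = n (n + 1) / 2\<close> linear forms \<open>\<phi>\<^sub>s\<close> on \<open>A\<close> whose squares form a basis of the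
  symmetric bilinear forms. Every commutative product then has a unique expansion
  \<open>x y = \<Sum>\<^sub>s \<phi>\<^sub>s(x) \<phi>\<^sub>s(y) w\<^sub>s\<close> with \<open>w\<^sub>s \<in> A\<close>. Let \<open>\<psi> = (\<phi>\<^sub>s)\<^sub>s\<close> be the resulting map from \<open>A\<close> to the
  functions on the index set and put \<open>f g = \<psi> (\<Sum>\<^sub>s f\<^sub>s g\<^sub>s w\<^sub>s)\<close> for two such functions. The unit
  functions are a natural basis, \<open>\<psi>\<close> is multiplicative by the expansion above, and every product
  lies in the image of \<open>\<psi>\<close>.

  For coordinates \<open>x\<^sub>b\<close> with respect to a basis \<open>B\<close>, the forms \<open>x\<^sub>b\<close> and \<open>x\<^sub>b + x\<^sub>c\<close> (\<open>b \<noteq> c\<close>) do, in any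
  characteristic. They are indexed by the subsets of \<open>B\<close> with one or two elements, and the
  coefficients are \<open>w\<^bsub>{b,c}\<^esub> = b c\<close> and \<open>w\<^bsub>{b}\<^esub> = b b - \<Sum>\<^bsub>c \<noteq> b\<^esub> c b\<close>.
\<close>

section \<open>Quotient algebras\<close>

context nonassoc_algebra_ideal
begin

text \<open>Negation is scaling by -1, so a subspace is closed under it. The result opens the coset
  calculus of abelian groups for \<open>I\<close>.\<close>

lemma is_abelian_subgroup: "abelian_subgroup I A"
proof -
  interpret I: LinearCombinations.submodule K I A by (rule submod)
  have "\<ominus>\<^bsub>A\<^esub> x \<in> I" if "x \<in> I" for x
    using that I.subset by (subst smult_minus_1[symmetric]) auto
  then have "subgroup I (add_monoid A)"
    using I.subset by unfold_locales (auto simp: a_inv_def[symmetric])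
  then show ?thesis
    by (simp add: abelian_subgroupI3 additive_subgroup_def abelian_group_axioms)
qed

sublocale abelian_subgroup I A
  by (rule is_abelian_subgroup)

section \<open>Computing with representatives of cosets\<close>

lemma quotient_carrier: "carrier (quotient_algebra A I) = (+>\<^bsub>A\<^esub>) I ` carrier A"
  by (auto simp: quotient_algebra_def ring.defs module.defs FactRing_def A_RCOSETS_def')

lemma quotient_zero: "\<zero>\<^bsub>quotient_algebra A I\<^esub> = I"
  by (simp add: quotient_algebra_def ring.defs module.defs FactRing_def)

lemma quotient_add:
  "\<lbrakk>x \<in> carrier A; y \<in> carrier A\<rbrakk> \<Longrightarrow>
    (I +>\<^bsub>A\<^esub> x) \<oplus>\<^bsub>quotient_algebra A I\<^esub> (I +>\<^bsub>A\<^esub> y) = I +>\<^bsub>A\<^esub> (x \<oplus>\<^bsub>A\<^esub> y)"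
  by (simp add: quotient_algebra_def ring.defs module.defs FactRing_def a_rcos_sum)

lemma coset_eqI:
  assumes "x \<in> carrier A" "y \<in> carrier A" "h \<in> I" "y = h \<oplus>\<^bsub>A\<^esub> x"
  shows "I +>\<^bsub>A\<^esub> y = I +>\<^bsub>A\<^esub> x"
proof -
  have "y \<in> I +>\<^bsub>A\<^esub> x" using assms by (auto simp: a_r_coset_def')
  then show ?thesis using a_repr_independence' assms(1) by metis
qed

lemma mem_cosetE:
  assumes "u \<in> I +>\<^bsub>A\<^esub> x"
  obtains h where "h \<in> I" "u = h \<oplus>\<^bsub>A\<^esub> x"
  using assms by (auto simp: a_r_coset_def')

text \<open>If u = h + x with h in \<open>I\<close>, then c u = c h + c x with c h in
  \<open>I\<close>, so every representative yields the same coset. The union in the definition is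
  then a union of equal sets, over a range that is nonempty because it contains
  \<open>x\<close>.\<close>

lemma quotient_smult:
  assumes c: "c \<in> carrier K" and x: "x \<in> carrier A"
  shows "c \<odot>\<^bsub>quotient_algebra A I\<^esub> (I +>\<^bsub>A\<^esub> x) = I +>\<^bsub>A\<^esub> (c \<odot>\<^bsub>A\<^esub> x)"
proof -
  interpret I: LinearCombinations.submodule K I A by (rule submod)
  have "I +>\<^bsub>A\<^esub> (c \<odot>\<^bsub>A\<^esub> u) = I +>\<^bsub>A\<^esub> (c \<odot>\<^bsub>A\<^esub> x)" if "u \<in> I +>\<^bsub>A\<^esub> x" for u
  proof -
    obtain h where h: "h \<in> I" "u = h \<oplus>\<^bsub>A\<^esub> x" using \<open>u \<in> _\<close> by (rule mem_cosetE)
    have "h \<in> carrier A" using h(1) a_subset by auto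
    then show ?thesis
      using c x h by (intro coset_eqI[where h = "c \<odot>\<^bsub>A\<^esub> h"]) (auto simp: smult_r_distr)
  qed
  moreover have "x \<in> I +>\<^bsub>A\<^esub> x" using x by (rule a_rcos_self)
  ultimately have "(\<Union>u\<in>I +>\<^bsub>A\<^esub> x. I +>\<^bsub>A\<^esub> (c \<odot>\<^bsub>A\<^esub> u)) = I +>\<^bsub>A\<^esub> (c \<odot>\<^bsub>A\<^esub> x)" by blast
  then show ?thesis by (simp add: quotient_algebra_def ring.defs module.defs FactRing_def)
qed

text \<open>For u = h + x and v = k + y with h, k in \<open>I\<close>, the difference u v - x y is h
  v + x k. The first summand lies in \<open>I\<close> by \<open>ideal_right\<close>, the second by
  \<open>ideal_left\<close>. Hence the union over representatives in \<open>rcoset_mult\<close> is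
  again one of equal sets.\<close>

lemma quotient_mult:
  assumes x: "x \<in> carrier A" and y: "y \<in> carrier A"
  shows "(I +>\<^bsub>A\<^esub> x) \<otimes>\<^bsub>quotient_algebra A I\<^esub> (I +>\<^bsub>A\<^esub> y) = I +>\<^bsub>A\<^esub> (x \<otimes>\<^bsub>A\<^esub> y)"
proof -
  have "I +>\<^bsub>A\<^esub> (u \<otimes>\<^bsub>A\<^esub> v) = I +>\<^bsub>A\<^esub> (x \<otimes>\<^bsub>A\<^esub> y)"
    if uv: "u \<in> I +>\<^bsub>A\<^esub> x" "v \<in> I +>\<^bsub>A\<^esub> y" for u v
  proof -
    obtain h where h: "h \<in> I" "u = h \<oplus>\<^bsub>A\<^esub> x" using uv(1) by (rule mem_cosetE)
    obtain k where k: "k \<in> I" "v = k \<oplus>\<^bsub>A\<^esub> y" using uv(2) by (rule mem_cosetE)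
    have hk: "h \<in> carrier A" "k \<in> carrier A" using h(1) k(1) a_subset by auto
    let ?d = "h \<otimes>\<^bsub>A\<^esub> v \<oplus>\<^bsub>A\<^esub> x \<otimes>\<^bsub>A\<^esub> k"
    have v: "v \<in> carrier A" using k hk y by simp
    have "?d \<in> I" using h(1) k(1) v x by (auto intro: ideal_left ideal_right)
    moreover have "u \<otimes>\<^bsub>A\<^esub> v = h \<otimes>\<^bsub>A\<^esub> v \<oplus>\<^bsub>A\<^esub> (x \<otimes>\<^bsub>A\<^esub> k \<oplus>\<^bsub>A\<^esub> x \<otimes>\<^bsub>A\<^esub> y)"
      using h(2) k(2)[symmetric] hk x y v by (simp add: product_add_left flip: product_add_right)
    then have "u \<otimes>\<^bsub>A\<^esub> v = ?d \<oplus>\<^bsub>A\<^esub> x \<otimes>\<^bsub>A\<^esub> y"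
      using hk x y v by (simp add: product_closed M.add.m_assoc)
    ultimately show ?thesis
      using h(2) hk x y v by (intro coset_eqI) (auto simp: product_closed)
  qed
  moreover have "x \<in> I +>\<^bsub>A\<^esub> x" "y \<in> I +>\<^bsub>A\<^esub> y" using x y by (auto intro: a_rcos_self)
  ultimately have "(\<Union>u\<in>I +>\<^bsub>A\<^esub> x. \<Union>v\<in>I +>\<^bsub>A\<^esub> y. I +>\<^bsub>A\<^esub> (u \<otimes>\<^bsub>A\<^esub> v)) = I +>\<^bsub>A\<^esub> (x \<otimes>\<^bsub>A\<^esub> y)"
    by blast
  then show ?thesis
    by (simp add: quotient_algebra_def ring.defs module.defs FactRing_def rcoset_mult_def)
qed

text \<open>Passing to cosets is onto and respects all operations, so each identity of
  \<open>A\<close> carries over to the quotient.\<close>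

theorem quotient_nonassoc_algebra: "nonassoc_algebra K (quotient_algebra A I)"
proof -
  \<comment> \<open>The zero of the quotient is \<open>I\<close> itself; written as the coset of
    zero it falls under the rules for cosets.\<close>
  have I_coset: "I = I +>\<^bsub>A\<^esub> \<zero>\<^bsub>A\<^esub>" using a_subset by simp
  have "vectorspace K (quotient_algebra A I)"
  proof (rule vs_criteria)
    show "\<zero>\<^bsub>quotient_algebra A I\<^esub> \<in> carrier (quotient_algebra A I)"
      using I_coset by (auto simp: quotient_carrier quotient_zero)
    show "\<forall>v\<in>carrier (quotient_algebra A I). \<exists>w\<in>carrier (quotient_algebra A I).
        v \<oplus>\<^bsub>quotient_algebra A I\<^esub> w = \<zero>\<^bsub>quotient_algebra A I\<^esub>"
    proof
      fix v assume "v \<in> carrier (quotient_algebra A I)"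
      then obtain x where "x \<in> carrier A" "v = I +>\<^bsub>A\<^esub> x" by (auto simp: quotient_carrier)
      then show "\<exists>w\<in>carrier (quotient_algebra A I).
          v \<oplus>\<^bsub>quotient_algebra A I\<^esub> w = \<zero>\<^bsub>quotient_algebra A I\<^esub>"
        using I_coset by (intro bexI[of _ "I +>\<^bsub>A\<^esub> (\<ominus>\<^bsub>A\<^esub> x)"])
          (auto simp: quotient_carrier quotient_add quotient_zero M.r_neg)
    qed
    show "\<forall>v\<in>carrier (quotient_algebra A I).
        v \<oplus>\<^bsub>quotient_algebra A I\<^esub> \<zero>\<^bsub>quotient_algebra A I\<^esub> = v"
      by (subst quotient_zero, subst I_coset) (auto simp: quotient_carrier quotient_add)
  qed (auto simp: quotient_carrier quotient_add quotient_smult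
        M.a_ac smult_l_distr smult_r_distr smult_assoc1
        field_axioms)
  then interpret Q: vectorspace K "quotient_algebra A I" .
  show ?thesis
    by unfold_locales
      (auto simp: quotient_carrier quotient_add quotient_smult quotient_mult product_closed
        product_add_left product_add_right product_smult_left product_smult_right)
qed

text \<open>The product of two cosets is the coset of a member of \<open>I\<close>, which is
  \<open>I\<close>, the zero of the quotient.\<close>

lemma quotient_degenerate:
  assumes "\<And>x y. \<lbrakk>x \<in> carrier A; y \<in> carrier A\<rbrakk> \<Longrightarrow> x \<otimes>\<^bsub>A\<^esub> y \<in> I"
  shows "degenerate_algebra K (quotient_algebra A I)"
proof -
  interpret Q: nonassoc_algebra K "quotient_algebra A I" by (rule quotient_nonassoc_algebra)
  show ?thesis
    using assms by unfold_locales
      (auto simp: quotient_carrier quotient_mult quotient_zero a_rcos_const)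
qed

end

section \<open>Algebra structures on function spaces\<close>

text \<open>The vector space axioms say nothing about \<open>mult\<close>, but the updated record is
  a new structure, so they are verified for it afresh. This leaves the product on a function space
  free to be chosen.\<close>

lemma vectorspace_mult_update:
  fixes V :: "('k, 'v, 'm) module_scheme"
  assumes "vectorspace K V"
  shows "vectorspace K (V\<lparr>mult := m\<rparr>)"
proof -
  interpret vectorspace K V by (rule assms)
  show ?thesis
    by (rule vs_criteria)
      (auto simp: M.a_ac smult_l_distr smult_r_distr smult_assoc1 field_axioms intro: M.r_neg)
qed

abbreviation (in field) func_algebra ::
    "'s set \<Rightarrow> (('s \<Rightarrow> 'a) \<Rightarrow> ('s \<Rightarrow> 'a) \<Rightarrow> 's \<Rightarrow> 'a) \<Rightarrow> ('a, 's \<Rightarrow> 'a) module" where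
  "func_algebra S m \<equiv> (func_space S)\<lparr>mult := m\<rparr>"

text \<open>The standard basis vector at \<open>i\<close>; the restriction to \<open>S\<close> makes
  it extensional, as the members of the function space are.\<close>

definition (in field) unit_func :: "'s set \<Rightarrow> 's \<Rightarrow> 's \<Rightarrow> 'a" where
  "unit_func S i = (\<lambda>j\<in>S. if j = i then \<one> else \<zero>)"

context field
begin

lemma func_algebra_vectorspace: "vectorspace R (func_algebra S m)"
proof -
  have "vectorspace R (func_space S)"
    by (simp add: vectorspace_def func_space_is_module field_axioms)
  then show ?thesis by (rule vectorspace_mult_update)
qed

text \<open>Evaluation at a point of \<open>S\<close> is additive, hence commutes with finite sums
  by induction on \<open>T\<close>.\<close>

lemma func_algebra_finsum_apply:
  assumes "finite T" "f \<in> T \<rightarrow> carrier (func_algebra S m)" "i \<in> S"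
  shows "finsum (func_algebra S m) f T i = (\<Oplus>t\<in>T. f t i)"
proof -
  interpret X: vectorspace R "func_algebra S m" by (rule func_algebra_vectorspace)
  show ?thesis
    using assms
  proof (induction T rule: finite_induct)
    case empty
    then show ?case by (simp add: X.M.finsum_empty) (simp add: func_space_def)
  next
    case (insert t T)
    then have "finsum (func_algebra S m) f (insert t T)
        = f t \<oplus>\<^bsub>func_algebra S m\<^esub> finsum (func_algebra S m) f T"
      by (intro X.M.finsum_insert) auto
    moreover have "(\<Oplus>t\<in>insert t T. f t i) = f t i \<oplus> (\<Oplus>t\<in>T. f t i)"
      using insert by (intro finsum_insert) (auto simp: func_space_def PiE_iff Pi_iff)
    ultimately show ?case using insert by (simp add: func_space_def)
  qed
qed

lemma unit_func_apply: "i \<in> S \<Longrightarrow> unit_func S j i = (if i = j then \<one> else \<zero>)"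
  by (simp add: unit_func_def)

lemma inj_on_unit_func: "inj_on (unit_func S) S"
proof (rule inj_onI)
  fix i j assume "i \<in> S" "j \<in> S" "unit_func S i = unit_func S j"
  then have "unit_func S i i = unit_func S j i" by simp
  then show "i = j" using \<open>i \<in> S\<close> by (simp add: unit_func_def split: if_splits)
qed

lemma unit_funcs_closed: "unit_func S ` S \<subseteq> carrier (func_algebra S m)"
  by (auto simp: unit_func_def func_space_def)

text \<open>Evaluation at \<open>i\<close> kills every unit function except the one at
  \<open>i\<close>. Coefficients are indexed by the unit functions themselves, so injectivity of
  \<open>unit_func S\<close> serves to move the sum to \<open>S\<close>.\<close>

lemma func_algebra_lincomb_apply:
  assumes S: "finite S" and i: "i \<in> S" and a: "a \<in> unit_func S ` S \<rightarrow> carrier R"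
  shows "module.lincomb (func_algebra S m) a (unit_func S ` S) i = a (unit_func S i)"
proof -
  interpret X: vectorspace R "func_algebra S m" by (rule func_algebra_vectorspace)
  have a_closed: "a (unit_func S j) \<in> carrier R" if "j \<in> S" for j
    using a that by (auto simp: Pi_iff)
  have "module.lincomb (func_algebra S m) a (unit_func S ` S) i
      = (\<Oplus>b\<in>unit_func S ` S. (a b \<odot>\<^bsub>func_algebra S m\<^esub> b) i)"
    unfolding X.lincomb_def
  proof (rule func_algebra_finsum_apply)
    show "(\<lambda>b. a b \<odot>\<^bsub>func_algebra S m\<^esub> b) \<in> unit_func S ` S \<rightarrow> carrier (func_algebra S m)"
    proof
      fix b assume "b \<in> unit_func S ` S"
      then have "a b \<in> carrier R" "b \<in> carrier (func_algebra S m)"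
        using funcset_mem[OF a] subsetD[OF unit_funcs_closed] by simp_all
      then show "a b \<odot>\<^bsub>func_algebra S m\<^esub> b \<in> carrier (func_algebra S m)"
        by (rule X.smult_closed)
    qed
  qed (use S i in auto)
  also have "\<dots> = (\<Oplus>b\<in>unit_func S ` S. a b \<otimes> b i)"
    using i a_closed by (intro finsum_cong') (auto simp: func_space_def unit_func_apply)
  also have "\<dots> = (\<Oplus>j\<in>S. a (unit_func S j) \<otimes> unit_func S j i)"
    using i a_closed by (intro finsum_reindex inj_on_unit_func) (auto simp: unit_func_apply)
  also have "\<dots> = (\<Oplus>j\<in>S. if i = j then a (unit_func S j) else \<zero>)"
    using i a_closed by (intro finsum_cong') (auto simp: unit_func_apply)
  also have "\<dots> = a (unit_func S i)"
    using S i a_closed by (intro finsum_singleton) auto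
  finally show ?thesis .
qed

text \<open>In an expansion of \<open>v\<close> the coefficient of the unit function at i can only
  be \<open>v i\<close>, by evaluation at i, and this choice works. That is the unique existence
  \<open>basis_criterion\<close> asks for.\<close>

lemma unit_func_basis:
  assumes S: "finite S"
  shows "vectorspace.basis R (func_algebra S m) (unit_func S ` S)"
proof -
  interpret X: vectorspace R "func_algebra S m" by (rule func_algebra_vectorspace)
  let ?E = "unit_func S ` S"
  have carrier: "carrier (func_algebra S m) = S \<rightarrow>\<^sub>E carrier R" by (simp add: func_space_def)
  have E: "?E \<subseteq> carrier (func_algebra S m)" by (rule unit_funcs_closed)
  have "\<exists>!a. a \<in> ?E \<rightarrow>\<^sub>E carrier R \<and> X.lincomb a ?E = v" if v: "v \<in> carrier (func_algebra S m)" for v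
  proof (rule ex1I)
    \<comment> \<open>The inverse of \<open>unit_func S\<close> recovers the point i from its unit
      function, whose coefficient is to be \<open>v i\<close>.\<close>
    let ?a = "\<lambda>b\<in>?E. v (the_inv_into S (unit_func S) b)"
    have a: "?a \<in> ?E \<rightarrow>\<^sub>E carrier R"
      using v carrier by (auto simp: the_inv_into_f_f[OF inj_on_unit_func])
    have "X.lincomb ?a ?E i = v i" for i
    proof (cases "i \<in> S")
      case True
      moreover have "?a \<in> ?E \<rightarrow> carrier R" using a unfolding PiE_def by (rule IntD1)
      ultimately show ?thesis
        by (simp only: func_algebra_lincomb_apply[OF S True])
          (simp add: the_inv_into_f_f[OF inj_on_unit_func])
    next
      \<comment> \<open>Off \<open>S\<close> both sides take the default value of extensional
        functions.\<close>
      case False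
      have "?a \<in> ?E \<rightarrow> carrier R" using a unfolding PiE_def by (rule IntD1)
      then have "X.lincomb ?a ?E \<in> S \<rightarrow>\<^sub>E carrier R" using X.lincomb_closed[OF E] carrier by simp
      moreover have "v \<in> S \<rightarrow>\<^sub>E carrier R" using v carrier by (simp only:)
      ultimately show ?thesis using PiE_arb[OF _ False] by metis
    qed
    then show "?a \<in> ?E \<rightarrow>\<^sub>E carrier R \<and> X.lincomb ?a ?E = v" using a by (intro conjI ext)
    fix b assume b: "b \<in> ?E \<rightarrow>\<^sub>E carrier R \<and> X.lincomb b ?E = v"
    then have "b \<in> ?E \<rightarrow> carrier R" unfolding PiE_def by simp
    then have b_eq: "b (unit_func S i) = v i" if "i \<in> S" for i
      using func_algebra_lincomb_apply[OF S that, of b m] b by metis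
    show "b = ?a"
    proof (rule PiE_ext[OF conjunct1[OF b] a])
      fix e assume "e \<in> ?E"
      then obtain i where "i \<in> S" "e = unit_func S i" by blast
      then show "b e = ?a e" by (simp add: b_eq the_inv_into_f_f[OF inj_on_unit_func])
    qed
  qed
  then show ?thesis using S E by (simp add: X.basis_criterion)
qed

end

section \<open>The evolution algebra of a decomposition into squares\<close>

text \<open>The elements on which two homomorphisms agree form a submodule; containing
  \<open>G\<close>, it contains the span.\<close>

lemma (in module) module_hom_eq_on_span:
  assumes f: "f \<in> module_hom R M N" and g: "g \<in> module_hom R M N" and N: "module R N"
    and G: "G \<subseteq> carrier M" "span G = carrier M"
    and eq: "\<And>x. x \<in> G \<Longrightarrow> f x = g x"
    and x: "x \<in> carrier M"
  shows "f x = g x"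
proof -
  interpret f: mod_hom R M N f using f N by (simp add: mod_hom_def mod_hom_axioms_def module_axioms)
  interpret g: mod_hom R M N g using g N by (simp add: mod_hom_def mod_hom_axioms_def module_axioms)
  have "LinearCombinations.submodule R {x \<in> carrier M. f x = g x} M"
    by unfold_locales auto
  then have "span G \<subseteq> {x \<in> carrier M. f x = g x}"
    using G eq by (intro span_is_subset) auto
  then show ?thesis using G x by blast
qed

text \<open>The data from which the evolution algebra is built. The expansion of products into
  squares of forms is required on a generating set \<open>G\<close> only, such as a basis, where it
  can be checked directly. Separation of points will make the embedding injective.\<close>

locale square_decomposition = nonassoc_algebra K A for K (structure) and A (structure) +
  fixes S :: "'s set" and \<phi> and w and G
  assumes finite_index: "finite S"
    and form_closed: "\<lbrakk>s \<in> S; x \<in> carrier A\<rbrakk> \<Longrightarrow> \<phi> s x \<in> carrier K"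
    and form_add: "\<lbrakk>s \<in> S; x \<in> carrier A; y \<in> carrier A\<rbrakk> \<Longrightarrow> \<phi> s (x \<oplus>\<^bsub>A\<^esub> y) = \<phi> s x \<oplus> \<phi> s y"
    and form_smult: "\<lbrakk>s \<in> S; c \<in> carrier K; x \<in> carrier A\<rbrakk> \<Longrightarrow> \<phi> s (c \<odot>\<^bsub>A\<^esub> x) = c \<otimes> \<phi> s x"
    and forms_separate: "\<lbrakk>x \<in> carrier A; y \<in> carrier A; \<And>s. s \<in> S \<Longrightarrow> \<phi> s x = \<phi> s y\<rbrakk> \<Longrightarrow> x = y"
    and weight_closed: "s \<in> S \<Longrightarrow> w s \<in> carrier A"
    and generators_closed: "G \<subseteq> carrier A"
    and generators_span: "span G = carrier A"
    and generators_product: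
      "\<lbrakk>x \<in> G; y \<in> G\<rbrakk> \<Longrightarrow> x \<otimes>\<^bsub>A\<^esub> y = (\<Oplus>\<^bsub>A\<^esub>s\<in>S. (\<phi> s x \<otimes> \<phi> s y) \<odot>\<^bsub>A\<^esub> w s)"
begin

text \<open>The linear map to \<open>A\<close> that sends the unit function at s to
  \<open>w s\<close>.\<close>

definition combine :: "('s \<Rightarrow> 'a) \<Rightarrow> 'c" where
  "combine f = (\<Oplus>\<^bsub>A\<^esub>s\<in>S. f s \<odot>\<^bsub>A\<^esub> w s)"

text \<open>The embedding \<psi> of the overview, with extensional values.\<close>

definition coords :: "'c \<Rightarrow> 's \<Rightarrow> 'a" where
  "coords x = (\<lambda>s\<in>S. \<phi> s x)"

text \<open>A product is formed by multiplying pointwise, mapping to \<open>A\<close> by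
  \<open>combine\<close>, and returning by \<open>coords\<close>. The first stage makes the unit
  functions orthogonal; the last puts every product in the image of \<open>A\<close>.\<close>

abbreviation envelope :: "('a, 's \<Rightarrow> 'a) module" where
  "envelope \<equiv> func_algebra S (\<lambda>f g. coords (combine (\<lambda>s. f s \<otimes> g s)))"

lemma combine_closed: "f \<in> S \<rightarrow> carrier K \<Longrightarrow> combine f \<in> carrier A"
  unfolding combine_def using weight_closed by (auto intro!: M.finsum_closed)

lemma combine_cong:
  assumes "g \<in> S \<rightarrow> carrier K" "\<And>s. s \<in> S \<Longrightarrow> f s = g s"
  shows "combine f = combine g"
  unfolding combine_def using assms weight_closed by (intro M.finsum_cong') auto

text \<open>The condition on \<open>h\<close> is pointwise on \<open>S\<close>, so that the lemma
  also fits the restricted sums of the function space.\<close>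

lemma combine_add:
  assumes "f \<in> S \<rightarrow> carrier K" "g \<in> S \<rightarrow> carrier K" "\<And>s. s \<in> S \<Longrightarrow> h s = f s \<oplus> g s"
  shows "combine h = combine f \<oplus>\<^bsub>A\<^esub> combine g"
proof -
  have "combine h = (\<Oplus>\<^bsub>A\<^esub>s\<in>S. f s \<odot>\<^bsub>A\<^esub> w s \<oplus>\<^bsub>A\<^esub> g s \<odot>\<^bsub>A\<^esub> w s)"
    unfolding combine_def using assms weight_closed
    by (intro M.finsum_cong') (auto simp: smult_l_distr Pi_iff)
  also have "\<dots> = combine f \<oplus>\<^bsub>A\<^esub> combine g"
    unfolding combine_def using assms weight_closed by (intro M.finsum_addf) auto
  finally show ?thesis .
qed

lemma combine_smult:
  assumes "c \<in> carrier K" "f \<in> S \<rightarrow> carrier K" "\<And>s. s \<in> S \<Longrightarrow> h s = c \<otimes> f s"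
  shows "combine h = c \<odot>\<^bsub>A\<^esub> combine f"
proof -
  have "combine h = (\<Oplus>\<^bsub>A\<^esub>s\<in>S. c \<odot>\<^bsub>A\<^esub> (f s \<odot>\<^bsub>A\<^esub> w s))"
    unfolding combine_def using assms weight_closed
    by (intro M.finsum_cong') (auto simp: smult_assoc1 Pi_iff)
  also have "\<dots> = c \<odot>\<^bsub>A\<^esub> combine f"
    unfolding combine_def using assms weight_closed by (intro finsum_smult[symmetric]) auto
  finally show ?thesis .
qed

lemma combine_zero: "combine (\<lambda>s. \<zero>) = \<zero>\<^bsub>A\<^esub>"
  unfolding combine_def using weight_closed by (intro M.finsum_all0) auto

section \<open>Expansion of arbitrary products\<close>

lemma form_product_closed:
  "\<lbrakk>x \<in> carrier A; y \<in> carrier A\<rbrakk> \<Longrightarrow> (\<lambda>s. \<phi> s x \<otimes> \<phi> s y) \<in> S \<rightarrow> carrier K"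
  by (auto intro: form_closed)

lemma product_hom_right:
  "x \<in> carrier A \<Longrightarrow> (\<lambda>y. x \<otimes>\<^bsub>A\<^esub> y) \<in> module_hom K A A"
  by (auto simp: module_hom_def product_closed product_add_right product_smult_right)

lemma product_hom_left:
  "y \<in> carrier A \<Longrightarrow> (\<lambda>x. x \<otimes>\<^bsub>A\<^esub> y) \<in> module_hom K A A"
  by (auto simp: module_hom_def product_closed product_add_left product_smult_left)

lemma combine_hom_right:
  assumes "x \<in> carrier A"
  shows "(\<lambda>y. combine (\<lambda>s. \<phi> s x \<otimes> \<phi> s y)) \<in> module_hom K A A"
proof -
  note closed = form_product_closed[OF assms] form_closed[OF _ assms]
  have "combine (\<lambda>s. \<phi> s x \<otimes> \<phi> s (y \<oplus>\<^bsub>A\<^esub> z))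
      = combine (\<lambda>s. \<phi> s x \<otimes> \<phi> s y) \<oplus>\<^bsub>A\<^esub> combine (\<lambda>s. \<phi> s x \<otimes> \<phi> s z)"
    if "y \<in> carrier A" "z \<in> carrier A" for y z
    using that closed form_closed by (intro combine_add) (auto simp: form_add r_distr)
  moreover have "combine (\<lambda>s. \<phi> s x \<otimes> \<phi> s (c \<odot>\<^bsub>A\<^esub> y))
      = c \<odot>\<^bsub>A\<^esub> combine (\<lambda>s. \<phi> s x \<otimes> \<phi> s y)"
    if "c \<in> carrier K" "y \<in> carrier A" for c y
    using that closed form_closed by (intro combine_smult) (auto simp: form_smult m_lcomm)
  ultimately show ?thesis
    using closed by (auto simp: module_hom_def combine_closed)
qed

text \<open>Commutativity of \<open>K\<close> swaps the two arguments, which reduces linearity in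
  the first to linearity in the second.\<close>

lemma combine_hom_left:
  assumes "y \<in> carrier A"
  shows "(\<lambda>x. combine (\<lambda>s. \<phi> s x \<otimes> \<phi> s y)) \<in> module_hom K A A"
proof -
  have "combine (\<lambda>s. \<phi> s x \<otimes> \<phi> s y) = combine (\<lambda>s. \<phi> s y \<otimes> \<phi> s x)"
    if "x \<in> carrier A" for x
    using that assms form_closed
    by (intro combine_cong form_product_closed) (auto intro: m_comm)
  then show ?thesis
    using combine_hom_right[OF assms] by (auto simp: module_hom_def Pi_iff)
qed

text \<open>Both sides are bilinear and agree on pairs from \<open>G\<close>. One argument is
  treated at a time: \<open>x\<close> is reduced to a generator for the given \<open>y\<close>, and
  then \<open>y\<close> is reduced as well.\<close>

theorem product_eq_combine:
  assumes x: "x \<in> carrier A" and y: "y \<in> carrier A"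
  shows "x \<otimes>\<^bsub>A\<^esub> y = combine (\<lambda>s. \<phi> s x \<otimes> \<phi> s y)"
proof (rule module_hom_eq_on_span[OF product_hom_left[OF y] combine_hom_left[OF y] module_axioms
      generators_closed generators_span _ x])
  fix g assume g: "g \<in> G"
  then have "g \<in> carrier A" using generators_closed by blast
  note homs = product_hom_right[OF this] combine_hom_right[OF this]
  show "g \<otimes>\<^bsub>A\<^esub> y = combine (\<lambda>s. \<phi> s g \<otimes> \<phi> s y)"
  proof (rule module_hom_eq_on_span[OF homs module_axioms generators_closed generators_span _ y])
    fix h assume "h \<in> G"
    then show "g \<otimes>\<^bsub>A\<^esub> h = combine (\<lambda>s. \<phi> s g \<otimes> \<phi> s h)"
      using g generators_product by (simp add: combine_def)
  qed
qed

section \<open>Algebra structure on the function space\<close>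

lemma envelope_carrier: "carrier envelope = S \<rightarrow>\<^sub>E carrier K"
  by (simp add: func_space_def)

lemma envelope_mult: "f \<otimes>\<^bsub>envelope\<^esub> g = coords (combine (\<lambda>s. f s \<otimes> g s))"
  by simp

lemma envelope_add: "f \<oplus>\<^bsub>envelope\<^esub> g = (\<lambda>s\<in>S. f s \<oplus> g s)"
  by (simp add: func_space_def)

lemma envelope_smult: "c \<odot>\<^bsub>envelope\<^esub> f = (\<lambda>s\<in>S. c \<otimes> f s)"
  by (simp add: func_space_def)

lemma pointwise_product_closed:
  "\<lbrakk>f \<in> carrier envelope; g \<in> carrier envelope\<rbrakk> \<Longrightarrow> (\<lambda>s. f s \<otimes> g s) \<in> S \<rightarrow> carrier K"
  unfolding envelope_carrier by (auto simp: PiE_iff)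

lemma coords_linear: "linear_map K A envelope coords"
proof -
  interpret X: vectorspace K envelope by (rule func_algebra_vectorspace)
  have "coords \<in> module_hom K A envelope"
    unfolding module_hom_def envelope_carrier envelope_add envelope_smult
    by (auto simp: coords_def form_closed form_add form_smult cong: restrict_cong)
  then show ?thesis by unfold_locales
qed

lemma coords_inj: "inj_on coords (carrier A)"
  by (rule inj_onI) (metis coords_def forms_separate restrict_apply')

text \<open>The pointwise product is bilinear and is followed by the linear maps
  \<open>combine\<close> and \<open>coords\<close>.\<close>

lemma envelope_algebra: "nonassoc_algebra K envelope"
proof -
  interpret X: vectorspace K envelope by (rule func_algebra_vectorspace)
  interpret c: linear_map K A envelope coords by (rule coords_linear)
  note closed = pointwise_product_closed combine_closed[OF pointwise_product_closed]
  have app: "f s \<in> carrier K" if "f \<in> carrier envelope" "s \<in> S" for f s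
    using that unfolding envelope_carrier by auto
  have scale: "c \<otimes> f s \<otimes> g s = c \<otimes> (f s \<otimes> g s)" "f s \<otimes> (c \<otimes> g s) = c \<otimes> (f s \<otimes> g s)"
    if "c \<in> carrier K" "f \<in> carrier envelope" "g \<in> carrier envelope" "s \<in> S" for c f g s
    using that app by (auto simp: m_assoc m_lcomm)
  show ?thesis
  proof
    fix f g h c
    assume f: "f \<in> carrier envelope" and g: "g \<in> carrier envelope"
    show "f \<otimes>\<^bsub>envelope\<^esub> g \<in> carrier envelope"
      unfolding envelope_mult using f g by (intro c.f_im closed)
    {
      assume h: "h \<in> carrier envelope"
      have "combine (\<lambda>s. (f \<oplus>\<^bsub>envelope\<^esub> g) s \<otimes> h s)
          = combine (\<lambda>s. f s \<otimes> h s) \<oplus>\<^bsub>A\<^esub> combine (\<lambda>s. g s \<otimes> h s)"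
        using f g h by (intro combine_add closed) (auto simp only: envelope_add restrict_apply' l_distr app)
      then show "(f \<oplus>\<^bsub>envelope\<^esub> g) \<otimes>\<^bsub>envelope\<^esub> h
          = f \<otimes>\<^bsub>envelope\<^esub> h \<oplus>\<^bsub>envelope\<^esub> g \<otimes>\<^bsub>envelope\<^esub> h"
        unfolding envelope_mult using f g h by (simp only: c.f_add closed)
      have "combine (\<lambda>s. f s \<otimes> (g \<oplus>\<^bsub>envelope\<^esub> h) s)
          = combine (\<lambda>s. f s \<otimes> g s) \<oplus>\<^bsub>A\<^esub> combine (\<lambda>s. f s \<otimes> h s)"
        using f g h by (intro combine_add closed) (auto simp only: envelope_add restrict_apply' r_distr app)
      then show "f \<otimes>\<^bsub>envelope\<^esub> (g \<oplus>\<^bsub>envelope\<^esub> h)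
          = f \<otimes>\<^bsub>envelope\<^esub> g \<oplus>\<^bsub>envelope\<^esub> f \<otimes>\<^bsub>envelope\<^esub> h"
        unfolding envelope_mult using f g h by (simp only: c.f_add closed)
    }
    assume c: "c \<in> carrier K"
    have "combine (\<lambda>s. (c \<odot>\<^bsub>envelope\<^esub> f) s \<otimes> g s) = c \<odot>\<^bsub>A\<^esub> combine (\<lambda>s. f s \<otimes> g s)"
      using f g c by (intro combine_smult closed) (auto simp only: envelope_smult restrict_apply' scale)
    then show "c \<odot>\<^bsub>envelope\<^esub> f \<otimes>\<^bsub>envelope\<^esub> g = c \<odot>\<^bsub>envelope\<^esub> (f \<otimes>\<^bsub>envelope\<^esub> g)"
      unfolding envelope_mult using f g c by (simp only: c.f_smult closed)
    have "combine (\<lambda>s. f s \<otimes> (c \<odot>\<^bsub>envelope\<^esub> g) s) = c \<odot>\<^bsub>A\<^esub> combine (\<lambda>s. f s \<otimes> g s)"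
      using f g c by (intro combine_smult closed) (auto simp only: envelope_smult restrict_apply' scale)
    then show "f \<otimes>\<^bsub>envelope\<^esub> (c \<odot>\<^bsub>envelope\<^esub> g) = c \<odot>\<^bsub>envelope\<^esub> (f \<otimes>\<^bsub>envelope\<^esub> g)"
      unfolding envelope_mult using f g c by (simp only: c.f_smult closed)
  qed
qed

text \<open>Distinct unit functions have disjoint supports, so their pointwise product vanishes
  already before \<open>combine\<close> and \<open>coords\<close> are applied.\<close>

lemma envelope_evolution: "evolution_algebra K envelope"
proof -
  interpret X: nonassoc_algebra K envelope by (rule envelope_algebra)
  interpret c: linear_map K A envelope coords by (rule coords_linear)
  have "unit_func S i \<otimes>\<^bsub>envelope\<^esub> unit_func S j = \<zero>\<^bsub>envelope\<^esub>"
    if "unit_func S i \<noteq> unit_func S j" for i j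
  proof -
    have "combine (\<lambda>s. unit_func S i s \<otimes> unit_func S j s) = combine (\<lambda>s. \<zero>)"
      using that by (intro combine_cong) (auto simp: unit_func_apply)
    then show ?thesis by (simp only: envelope_mult combine_zero c.f0_is_0)
  qed
  then have "X.natural_basis (unit_func S ` S)"
    unfolding X.natural_basis_def
    by (intro conjI unit_func_basis[OF finite_index] ballI impI; elim imageE; simp only:)
  then show ?thesis by unfold_locales blast
qed

section \<open>Dimension, embedding and image\<close>

lemma envelope_dim: "vectorspace.fin_dim K envelope" "vectorspace.dim K envelope = card S"
proof -
  interpret X: vectorspace K envelope by (rule func_algebra_vectorspace)
  have E: "X.basis (unit_func S ` S)" by (rule unit_func_basis[OF finite_index])
  then show "X.fin_dim" unfolding X.fin_dim_def X.basis_def using finite_index by blast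
  show "X.dim = card S"
    using X.dim_basis[OF _ E] finite_index by (simp add: card_image[OF inj_on_unit_func])
qed

text \<open>On the image of \<open>coords\<close> the pointwise product has the entries
  \<open>\<phi> s x \<otimes> \<phi> s y\<close>, so \<open>combine\<close> returns the product of x
  and y by \<open>product_eq_combine\<close>.\<close>

lemma coords_hom: "nonassoc_algebra_hom K A envelope coords"
proof -
  interpret X: nonassoc_algebra K envelope by (rule envelope_algebra)
  interpret c: linear_map K A envelope coords by (rule coords_linear)
  have "coords (x \<otimes>\<^bsub>A\<^esub> y) = coords x \<otimes>\<^bsub>envelope\<^esub> coords y"
    if xy: "x \<in> carrier A" "y \<in> carrier A" for x y
  proof -
    have "combine (\<lambda>s. coords x s \<otimes> coords y s) = combine (\<lambda>s. \<phi> s x \<otimes> \<phi> s y)"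
      using xy by (intro combine_cong form_product_closed) (auto simp: coords_def)
    then show ?thesis using xy by (simp only: envelope_mult product_eq_combine)
  qed
  then show ?thesis by unfold_locales
qed

text \<open>Products in the envelope end with \<open>coords\<close>. This yields both that the image
  is a two-sided ideal and that products vanish modulo it.\<close>

lemma envelope_product_in_range:
  "\<lbrakk>f \<in> carrier envelope; g \<in> carrier envelope\<rbrakk> \<Longrightarrow> f \<otimes>\<^bsub>envelope\<^esub> g \<in> coords ` carrier A"
  unfolding envelope_mult by (intro imageI combine_closed pointwise_product_closed)

lemma coords_ideal: "nonassoc_algebra_ideal K (coords ` carrier A) envelope"
proof -
  interpret X: nonassoc_algebra K envelope by (rule envelope_algebra)
  interpret c: linear_map K A envelope coords by (rule coords_linear)
  have sub: "subspace K (coords ` carrier A) envelope"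
    using c.imT_is_subspace by (simp only: c.im_def)
  have "coords ` carrier A \<subseteq> carrier envelope" using c.f_im by blast
  then show ?thesis
    using sub envelope_product_in_range
    by (intro nonassoc_algebra_ideal.intro nonassoc_algebra_ideal_axioms.intro X.nonassoc_algebra_axioms)
      blast+
qed

lemma quotient_by_coords_degenerate:
  "degenerate_algebra K (quotient_algebra envelope (coords ` carrier A))"
  using envelope_product_in_range by (rule nonassoc_algebra_ideal.quotient_degenerate[OF coords_ideal])

end

section \<open>Squares of the forms attached to a basis\<close>

text \<open>The coordinates of \<open>v\<close>. Extensionality makes the coefficient function
  itself unique for a finite basis, and not just its values on \<open>B\<close>.\<close>

definition (in vectorspace) basis_coeff :: "'c set \<Rightarrow> 'c \<Rightarrow> 'c \<Rightarrow> 'a" where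
  "basis_coeff B v = (THE c. c \<in> B \<rightarrow>\<^sub>E carrier K \<and> lincomb c B = v)"

context vectorspace
begin

context
  fixes B
  assumes fin: "finite B" and basis: "basis B"
begin

lemma basis_closed: "B \<subseteq> carrier V"
  using basis by (simp add: basis_def)

lemma basis_coeff:
  assumes "v \<in> carrier V"
  shows "basis_coeff B v \<in> B \<rightarrow>\<^sub>E carrier K" "lincomb (basis_coeff B v) B = v"
proof -
  have "\<exists>!c. c \<in> B \<rightarrow>\<^sub>E carrier K \<and> lincomb c B = v"
    using basis_criterion[OF fin basis_closed] basis assms by blast
  from theI'[OF this]
  show "basis_coeff B v \<in> B \<rightarrow>\<^sub>E carrier K" "lincomb (basis_coeff B v) B = v"
    by (simp_all add: basis_coeff_def)
qed

lemma basis_coeff_closed: "\<lbrakk>v \<in> carrier V; b \<in> B\<rbrakk> \<Longrightarrow> basis_coeff B v b \<in> carrier K"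
  using basis_coeff(1) by blast

text \<open>Restricting \<open>c\<close> to \<open>B\<close> keeps the linear combination and makes
  the function extensional, so it must be the coordinate function.\<close>

lemma basis_coeff_unique:
  assumes c: "c \<in> B \<rightarrow> carrier K" and b: "b \<in> B"
  shows "basis_coeff B (lincomb c B) b = c b"
proof -
  let ?v = "lincomb c B"
  have v: "?v \<in> carrier V" using basis_closed c by (rule lincomb_closed)
  have "lincomb (restrict c B) B = ?v"
    using basis_closed c by (intro lincomb_cong) auto
  moreover have "restrict c B \<in> B \<rightarrow>\<^sub>E carrier K" using c by auto
  moreover have "\<exists>!c. c \<in> B \<rightarrow>\<^sub>E carrier K \<and> lincomb c B = ?v"
    using basis_criterion[OF fin basis_closed] basis v by blast
  ultimately have "basis_coeff B ?v = restrict c B" using basis_coeff[OF v] by blast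
  then show ?thesis using b by simp
qed

text \<open>The pointwise sum of the coordinate functions combines to v + w, and coordinates are
  unique. Scaling is treated alike.\<close>

lemma basis_coeff_add:
  assumes v: "v \<in> carrier V" and w: "w \<in> carrier V" and b: "b \<in> B"
  shows "basis_coeff B (v \<oplus>\<^bsub>V\<^esub> w) b = basis_coeff B v b \<oplus>\<^bsub>K\<^esub> basis_coeff B w b"
proof -
  have "basis_coeff B v \<in> B \<rightarrow> carrier K" "basis_coeff B w \<in> B \<rightarrow> carrier K"
    using v w basis_coeff_closed by auto
  then show ?thesis
    using basis_coeff_unique[of "\<lambda>b. basis_coeff B v b \<oplus>\<^bsub>K\<^esub> basis_coeff B w b" b] b
      lincomb_sum[OF fin basis_closed] basis_coeff(2)[OF v] basis_coeff(2)[OF w]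
    by (simp add: Pi_iff)
qed

lemma basis_coeff_smult:
  assumes c: "c \<in> carrier K" and v: "v \<in> carrier V" and b: "b \<in> B"
  shows "basis_coeff B (c \<odot>\<^bsub>V\<^esub> v) b = c \<otimes>\<^bsub>K\<^esub> basis_coeff B v b"
proof -
  have "basis_coeff B v \<in> B \<rightarrow> carrier K" using v basis_coeff_closed by auto
  then show ?thesis
    using basis_coeff_unique[of "\<lambda>b. c \<otimes>\<^bsub>K\<^esub> basis_coeff B v b" b] b c
      lincomb_smult[OF basis_closed] basis_coeff(2)[OF v]
    by (simp add: Pi_iff)
qed

lemma basis_coeff_basis:
  assumes a: "a \<in> B" and b: "b \<in> B"
  shows "basis_coeff B a b = (if a = b then \<one>\<^bsub>K\<^esub> else \<zero>\<^bsub>K\<^esub>)"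
proof -
  let ?c = "\<lambda>b. if a = b then \<one>\<^bsub>K\<^esub> else \<zero>\<^bsub>K\<^esub>"
  have "lincomb ?c B = (\<Oplus>\<^bsub>V\<^esub>b\<in>B. if a = b then b else \<zero>\<^bsub>V\<^esub>)"
    unfolding lincomb_def using basis_closed by (intro M.finsum_cong') auto
  also have "\<dots> = a"
    using a fin basis_closed by (intro M.finsum_singleton) auto
  finally show ?thesis
    using basis_coeff_unique[of ?c b] b by auto
qed

lemma basis_coeff_eqI:
  assumes "v \<in> carrier V" "w \<in> carrier V"
    and "\<And>b. b \<in> B \<Longrightarrow> basis_coeff B v b = basis_coeff B w b"
  shows "v = w"
proof -
  have "basis_coeff B v = basis_coeff B w"
    by (rule PiE_ext[OF basis_coeff(1)[OF assms(1)] basis_coeff(1)[OF assms(2)] assms(3)])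
  then show ?thesis using basis_coeff(2) assms by metis
qed

end

end

text \<open>The index set. It encodes unordered pairs with repetition: a singleton stands for a pair
  with equal entries.\<close>

definition singletons_and_pairs :: "'a set \<Rightarrow> 'a set set" where
  "singletons_and_pairs B = {p. p \<subseteq> B \<and> (card p = 1 \<or> card p = 2)}"

lemma finite_singletons_and_pairs: "finite B \<Longrightarrow> finite (singletons_and_pairs B)"
  by (simp add: singletons_and_pairs_def)

text \<open>For n = \<open>card B\<close> the two sizes contribute n and n choose 2, which add up to
  n + 1 choose 2 by Pascal's rule.\<close>

lemma card_singletons_and_pairs:
  assumes "finite B"
  shows "card (singletons_and_pairs B) = card B * (card B + 1) div 2"
proof -
  have "singletons_and_pairs B = {p. p \<subseteq> B \<and> card p = 1} \<union> {p. p \<subseteq> B \<and> card p = 2}"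
    by (auto simp: singletons_and_pairs_def)
  then have "card (singletons_and_pairs B) = (card B choose 1) + (card B choose 2)"
    using assms by (simp only: n_subsets[symmetric]) (subst card_Un_disjoint, auto)
  also have "\<dots> = Suc (card B) choose 2" by (simp add: numeral_2_eq_2)
  finally show ?thesis by (simp add: choose_two mult.commute)
qed

text \<open>At most two elements are available, and two distinct ones exhaust them. For distinct
  basis vectors this leaves a single index whose form is nonzero at both.\<close>

lemma singletons_and_pairs_mem:
  assumes "p \<in> singletons_and_pairs B" "k \<in> p" "l \<in> p" "k \<noteq> l"
  shows "p = {k, l}"
  using assms by (auto simp: singletons_and_pairs_def card_1_singleton_iff card_2_iff)

text \<open>Products indexed by unordered pairs; since \<open>{x, x}\<close> is a singleton,
  singletons yield squares.\<close>

definition (in commutative_nonassoc_algebra) pair_product :: "'c set \<Rightarrow> 'c" where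
  "pair_product p = (THE z. \<exists>x y. p = {x, y} \<and> z = x \<otimes>\<^bsub>A\<^esub> y)"

definition (in commutative_nonassoc_algebra) pair_form :: "'c set \<Rightarrow> 'c set \<Rightarrow> 'c \<Rightarrow> 'a" where
  "pair_form B p x = (\<Oplus>b\<in>p. basis_coeff B x b)"

text \<open>The weight of a singleton is corrected by what the pairs through the same basis vector
  will contribute to its square.\<close>

definition (in commutative_nonassoc_algebra) pair_weight :: "'c set \<Rightarrow> 'c set \<Rightarrow> 'c" where
  "pair_weight B p =
    (if card p = 2 then pair_product p
     else pair_product p \<ominus>\<^bsub>A\<^esub> (\<Oplus>\<^bsub>A\<^esub>b\<in>B - p. pair_product (insert b p)))"

context commutative_nonassoc_algebra
begin

text \<open>The set \<open>{x, y}\<close> determines its members up to order, and the order is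
  immaterial by \<open>product_commute\<close>.\<close>

lemma pair_product: "\<lbrakk>x \<in> carrier A; y \<in> carrier A\<rbrakk> \<Longrightarrow> pair_product {x, y} = x \<otimes>\<^bsub>A\<^esub> y"
  unfolding pair_product_def by (rule the_equality) (auto simp: doubleton_eq_iff product_commute)

lemma pair_product_singleton: "x \<in> carrier A \<Longrightarrow> pair_product {x} = x \<otimes>\<^bsub>A\<^esub> x"
  using pair_product[of x x] by simp

context
  fixes B
  assumes fin: "finite B" and basis: "basis B"
begin

lemma pair_weight_singleton:
  assumes k: "k \<in> B"
  shows "pair_weight B {k} = k \<otimes>\<^bsub>A\<^esub> k \<ominus>\<^bsub>A\<^esub> (\<Oplus>\<^bsub>A\<^esub>b\<in>B - {k}. b \<otimes>\<^bsub>A\<^esub> k)"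
proof -
  have B: "b \<in> carrier A" if "b \<in> B" for b using that basis_closed[OF fin basis] by blast
  have "(\<Oplus>\<^bsub>A\<^esub>b\<in>B - {k}. pair_product (insert b {k})) = (\<Oplus>\<^bsub>A\<^esub>b\<in>B - {k}. b \<otimes>\<^bsub>A\<^esub> k)"
    using B k by (intro M.finsum_cong') (auto simp: pair_product product_closed)
  then show ?thesis using B k by (simp add: pair_weight_def pair_product_singleton)
qed

lemma pair_weight_pair: "\<lbrakk>k \<in> B; l \<in> B; k \<noteq> l\<rbrakk> \<Longrightarrow> pair_weight B {k, l} = k \<otimes>\<^bsub>A\<^esub> l"
  using basis_closed[OF fin basis] by (auto simp: pair_weight_def intro!: pair_product)

lemma pair_weight_closed:
  assumes "p \<in> singletons_and_pairs B"
  shows "pair_weight B p \<in> carrier A"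
proof -
  have B: "b \<in> carrier A" if "b \<in> B" for b using that basis_closed[OF fin basis] by blast
  consider k where "k \<in> B" "p = {k}" | k l where "k \<in> B" "l \<in> B" "k \<noteq> l" "p = {k, l}"
    using assms by (auto simp: singletons_and_pairs_def card_1_singleton_iff card_2_iff)
  then show ?thesis
    using B by cases
      (auto simp: pair_weight_singleton pair_weight_pair product_closed
        intro!: M.minus_closed M.finsum_closed)
qed

lemma pair_form_closed:
  "\<lbrakk>p \<subseteq> B; x \<in> carrier A\<rbrakk> \<Longrightarrow> pair_form B p x \<in> carrier K"
  unfolding pair_form_def using basis_coeff_closed[OF fin basis] by (intro R.finsum_closed) auto

lemma pair_form_add:
  assumes "p \<subseteq> B" "x \<in> carrier A" "y \<in> carrier A"
  shows "pair_form B p (x \<oplus>\<^bsub>A\<^esub> y) = pair_form B p x \<oplus> pair_form B p y"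
proof -
  have "pair_form B p (x \<oplus>\<^bsub>A\<^esub> y) = (\<Oplus>b\<in>p. basis_coeff B x b \<oplus> basis_coeff B y b)"
    unfolding pair_form_def using assms basis_coeff_closed[OF fin basis]
    by (intro R.finsum_cong') (auto simp: basis_coeff_add[OF fin basis] subset_iff)
  then show ?thesis
    unfolding pair_form_def using assms basis_coeff_closed[OF fin basis]
    by (simp add: R.finsum_addf subset_iff Pi_iff)
qed

lemma pair_form_smult:
  assumes "p \<subseteq> B" "c \<in> carrier K" "x \<in> carrier A"
  shows "pair_form B p (c \<odot>\<^bsub>A\<^esub> x) = c \<otimes> pair_form B p x"
proof -
  have "pair_form B p (c \<odot>\<^bsub>A\<^esub> x) = (\<Oplus>b\<in>p. c \<otimes> basis_coeff B x b)"
    unfolding pair_form_def using assms basis_coeff_closed[OF fin basis]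
    by (intro R.finsum_cong') (auto simp: basis_coeff_smult[OF fin basis] subset_iff)
  then show ?thesis
    unfolding pair_form_def using assms basis_coeff_closed[OF fin basis] finite_subset[OF _ fin]
    by (simp add: R.finsum_rdistr subset_iff Pi_iff)
qed

text \<open>The coordinates of \<open>k\<close> are Kronecker deltas, and \<open>k\<close> occurs at
  most once in \<open>p\<close>. No value other than 0 and 1 arises, so the characteristic never
  enters.\<close>

lemma pair_form_basis:
  assumes p: "p \<subseteq> B" and k: "k \<in> B"
  shows "pair_form B p k = (if k \<in> p then \<one> else \<zero>)"
proof -
  have "pair_form B p k = (\<Oplus>b\<in>p. if k = b then \<one> else \<zero>)"
    unfolding pair_form_def using p k
    by (intro R.finsum_cong') (auto simp: basis_coeff_basis[OF fin basis] subset_iff)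
  also have "\<dots> = (if k \<in> p then \<one> else \<zero>)"
    using R.finsum_singleton[of k p "\<lambda>_. \<one>"] finite_subset[OF p fin]
    by (auto intro: R.finsum_all0)
  finally show ?thesis .
qed

text \<open>The form of a singleton \<open>{b}\<close> is the coordinate at \<open>b\<close>, so the
  singletons already separate points.\<close>

lemma pair_forms_separate:
  assumes x: "x \<in> carrier A" and y: "y \<in> carrier A"
    and eq: "\<And>p. p \<in> singletons_and_pairs B \<Longrightarrow> pair_form B p x = pair_form B p y"
  shows "x = y"
proof (rule basis_coeff_eqI[OF fin basis x y])
  fix b assume b: "b \<in> B"
  then have "pair_form B {b} x = pair_form B {b} y"
    by (intro eq) (simp add: singletons_and_pairs_def)
  then show "basis_coeff B x b = basis_coeff B y b"
    using basis_coeff_closed[OF fin basis] x y b by (simp add: pair_form_def)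
qed

text \<open>Only the indices containing both \<open>k\<close> and \<open>l\<close> survive. For
  distinct vectors this is \<open>{k, l}\<close>, whose weight is the product. For equal ones they
  are \<open>{k}\<close> and all pairs through \<open>k\<close>, and the pairs cancel the correction
  in the weight of \<open>{k}\<close>.\<close>

lemma basis_product_decomposition:
  assumes k: "k \<in> B" and l: "l \<in> B"
  shows "k \<otimes>\<^bsub>A\<^esub> l =
    (\<Oplus>\<^bsub>A\<^esub>p\<in>singletons_and_pairs B. (pair_form B p k \<otimes> pair_form B p l) \<odot>\<^bsub>A\<^esub> pair_weight B p)"
    (is "_ = ?sum")
proof -
  let ?P = "singletons_and_pairs B"
  have B: "b \<in> carrier A" if "b \<in> B" for b using that basis_closed[OF fin basis] by blast
  have finP: "finite ?P" by (rule finite_singletons_and_pairs[OF fin])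
  have sub: "p \<subseteq> B" if "p \<in> ?P" for p using that by (simp add: singletons_and_pairs_def)
  have "?sum = (\<Oplus>\<^bsub>A\<^esub>p\<in>?P. if k \<in> p \<and> l \<in> p then pair_weight B p else \<zero>\<^bsub>A\<^esub>)"
    using k l by (intro M.finsum_cong') (auto simp: pair_form_basis sub pair_weight_closed)
  also have "\<dots> = k \<otimes>\<^bsub>A\<^esub> l"
  proof (cases "k = l")
    case False
    have kl: "{k, l} \<in> ?P" using k l False by (simp add: singletons_and_pairs_def)
    have "(\<Oplus>\<^bsub>A\<^esub>p\<in>?P. if k \<in> p \<and> l \<in> p then pair_weight B p else \<zero>\<^bsub>A\<^esub>)
        = (\<Oplus>\<^bsub>A\<^esub>p\<in>?P. if {k, l} = p then pair_weight B p else \<zero>\<^bsub>A\<^esub>)"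
      using singletons_and_pairs_mem[OF _ _ _ False]
      by (intro M.finsum_cong') (auto simp: pair_weight_closed)
    also have "\<dots> = pair_weight B {k, l}"
      using kl finP pair_weight_closed by (intro M.finsum_singleton) auto
    finally show ?thesis using k l False by (simp add: pair_weight_pair)
  next
    case True
    let ?pairs = "(\<lambda>b. {b, k}) ` (B - {k})"
    let ?rest = "\<Oplus>\<^bsub>A\<^esub>b\<in>B - {k}. b \<otimes>\<^bsub>A\<^esub> k"
    \<comment> \<open>Each pair through \<open>k\<close> is named by its other member b, which turns
      the sum over pairs into the sum in the weight of \<open>{k}\<close>.\<close>
    have Pk: "{p \<in> ?P. k \<in> p} = insert {k} ?pairs"
      using k by (auto simp: singletons_and_pairs_def card_1_singleton_iff card_2_iff)
    then have mem: "insert {k} ?pairs \<subseteq> ?P" by blast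
    have rest: "?rest \<in> carrier A" using B k by (auto intro!: M.finsum_closed product_closed)
    have inj: "inj_on (\<lambda>b. {b, k}) (B - {k})" by (auto simp: inj_on_def doubleton_eq_iff)
    have "(\<Oplus>\<^bsub>A\<^esub>p\<in>?P. if k \<in> p \<and> l \<in> p then pair_weight B p else \<zero>\<^bsub>A\<^esub>)
        = (\<Oplus>\<^bsub>A\<^esub>p\<in>{p \<in> ?P. k \<in> p}. pair_weight B p)"
      using finP True by (intro M.add.finprod_mono_neutral_cong_right) (auto intro: pair_weight_closed)
    also have "\<dots> = (\<Oplus>\<^bsub>A\<^esub>p\<in>insert {k} ?pairs. pair_weight B p)" by (simp only: Pk)
    also have "\<dots> = pair_weight B {k} \<oplus>\<^bsub>A\<^esub> (\<Oplus>\<^bsub>A\<^esub>p\<in>?pairs. pair_weight B p)"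
      using mem fin pair_weight_closed by (intro M.finsum_insert) (auto simp: doubleton_eq_iff)
    also have "(\<Oplus>\<^bsub>A\<^esub>p\<in>?pairs. pair_weight B p) = (\<Oplus>\<^bsub>A\<^esub>b\<in>B - {k}. pair_weight B {b, k})"
      using mem pair_weight_closed inj by (intro M.finsum_reindex) auto
    also have "\<dots> = ?rest"
      using B k by (intro M.finsum_cong') (auto simp: pair_weight_pair product_closed)
    \<comment> \<open>The weight of \<open>{k}\<close> is the square of \<open>k\<close> minus
      \<open>?rest\<close>, so the two occurrences of \<open>?rest\<close> cancel.\<close>
    also have "pair_weight B {k} \<oplus>\<^bsub>A\<^esub> ?rest = k \<otimes>\<^bsub>A\<^esub> k"
      using B k rest by (simp add: pair_weight_singleton M.minus_eq M.a_assoc M.l_neg product_closed)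
    finally show ?thesis using True by simp
  qed
  finally show ?thesis by simp
qed

end

end

section \<open>The embedding theorem\<close>

theorem theorem2p1:
  fixes F :: "('k, 'r) ring_scheme"
    and A :: "('k, 'a, 'm) module_scheme"
    and n :: nat
  assumes "field F"
    and "commutative_nonassoc_algebra F A"
    and "vectorspace.fin_dim F A"
    and "n = vectorspace.dim F A"
  shows "\<exists>(X :: ('k, nat \<Rightarrow> 'k) module) (\<psi> :: 'a \<Rightarrow> nat \<Rightarrow> 'k).
    evolution_algebra F X \<and>
    vectorspace.fin_dim F X \<and> vectorspace.dim F X = n * (n + 1) div 2 \<and>
    nonassoc_algebra_hom F A X \<psi> \<and>
    inj_on \<psi> (carrier A) \<and>
    nonassoc_algebra_ideal F (\<psi> ` carrier A) X \<and>
    degenerate_algebra F (quotient_algebra X (\<psi> ` carrier A))"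
proof -
  interpret commutative_nonassoc_algebra F A by (rule assms(2))
  obtain B where fin: "finite B" and basis: "basis B"
    using finite_basis_exists assms(3) by blast
  let ?P = "singletons_and_pairs B"
  let ?N = "card ?P"
  have card_P: "?N = n * (n + 1) div 2"
    using card_singletons_and_pairs[OF fin] dim_basis[OF fin basis] assms(4) by simp
  \<comment> \<open>The claim asks for functions on natural numbers, so the index sets are numbered
    from 0 by a bijection \<open>q\<close>.\<close>
  obtain q where "bij_betw q {0..<?N} ?P"
    using ex_bij_betw_nat_finite[OF finite_singletons_and_pairs[OF fin]] by blast
  then have inj: "inj_on q {0..<?N}" and range: "q ` {0..<?N} = ?P"
    by (simp_all add: bij_betw_def)
  have q: "q i \<in> ?P" "q i \<subseteq> B" if "i \<in> {0..<?N}" for i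
    using that range by (auto simp: singletons_and_pairs_def)
  interpret D: square_decomposition F A "{0..<?N}" "\<lambda>i. pair_form B (q i)"
    "\<lambda>i. pair_weight B (q i)" B
  proof
    show "span B = carrier A" "B \<subseteq> carrier A" using basis by (simp_all add: basis_def)
    fix x y
    assume xy: "x \<in> B" "y \<in> B"
    then have "x \<in> carrier A" "y \<in> carrier A" using basis by (auto simp: basis_def)
    then have "(\<lambda>p. (pair_form B p x \<otimes>\<^bsub>F\<^esub> pair_form B p y) \<odot>\<^bsub>A\<^esub> pair_weight B p)
        \<in> q ` {0..<?N} \<rightarrow> carrier A"
      unfolding range
      by (intro funcsetI smult_closed R.m_closed pair_form_closed[OF fin basis]
          pair_weight_closed[OF fin basis]) (simp_all add: singletons_and_pairs_def)
    \<comment> \<open>The expansion over index sets becomes one over their numbers.\<close>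
    from M.finsum_reindex[OF this inj]
    show "x \<otimes>\<^bsub>A\<^esub> y = (\<Oplus>\<^bsub>A\<^esub>i\<in>{0..<?N}.
        (pair_form B (q i) x \<otimes>\<^bsub>F\<^esub> pair_form B (q i) y) \<odot>\<^bsub>A\<^esub> pair_weight B (q i))"
      using basis_product_decomposition[OF fin basis xy] range by simp
  next
    fix x y
    assume xy: "x \<in> carrier A" "y \<in> carrier A"
      and eq: "\<And>i. i \<in> {0..<?N} \<Longrightarrow> pair_form B (q i) x = pair_form B (q i) y"
    have "pair_form B p x = pair_form B p y" if "p \<in> ?P" for p
    proof -
      have "p \<in> q ` {0..<?N}" using that unfolding range .
      then show ?thesis using eq by blast
    qed
    then show "x = y" by (rule pair_forms_separate[OF fin basis xy])
  next
    fix i x y c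
    assume i: "i \<in> {0..<?N}"
    note q = q[OF i]
    show "pair_weight B (q i) \<in> carrier A" using q(1) by (rule pair_weight_closed[OF fin basis])
    assume x: "x \<in> carrier A"
    show "pair_form B (q i) x \<in> carrier F" using q(2) x by (rule pair_form_closed[OF fin basis])
    show "pair_form B (q i) (c \<odot>\<^bsub>A\<^esub> x) = c \<otimes>\<^bsub>F\<^esub> pair_form B (q i) x" if "c \<in> carrier F"
      using q(2) that x by (rule pair_form_smult[OF fin basis])
    show "pair_form B (q i) (x \<oplus>\<^bsub>A\<^esub> y) = pair_form B (q i) x \<oplus>\<^bsub>F\<^esub> pair_form B (q i) y"
      if "y \<in> carrier A"
      using q(2) x that by (rule pair_form_add[OF fin basis])
  qed simp
  show ?thesis
  proof (intro exI conjI)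
    show "vectorspace.dim F D.envelope = n * (n + 1) div 2"
      unfolding card_P[symmetric] using D.envelope_dim(2) by (simp only: card_atLeastLessThan diff_zero)
  qed (rule D.envelope_evolution D.envelope_dim(1) D.coords_hom D.coords_inj D.coords_ideal
      D.quotient_by_coords_degenerate)+
qed

end
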